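(* Let $q$ be a square and $r\ge 1$, and let $\mathcal{H}$ be a Hermitian variety of $\mathrm{PG}(r,q)$. Let $\mathcal{K}'$ be the arc of $\mathrm{PG}(r,q)$ with $\mathcal{K}'(P)=\sqrt{q}$ if $P\in\mathcal{H}$ and $\mathcal{K}'(P)=0$ if $P\notin\mathcal{H}$. Then $\mathcal{K}'$ is a $(\sqrt{q}\bmod q)$-arc of $\mathrm{PG}(r,q)$. Moreover, if $\mathcal{H}$ is non-degenerate, then $\mathcal{K}'$ is not lifted.
   Context: A Hermitian variety of $\mathrm{PG}(r,q)$, $q$ a square, is the set of points $P(x)$ with $h(x,x)=0$, where $h$ is a Hermitian form on $\mathbb{F}_q^{r+1}$ (sesquilinear with respect to the involution $a\mapsto a^{\sqrt{q}}$ and satisfying $h(y,x)=h(x,y)^{\sqrt{q}}$); it is non-degenerate if $h$ is non-degenerate. An arc in $\mathrm{PG}(r,q)$ is a map $\mathcal{K}$ from the point set to the non-negative integers, with $\mathcal{K}(L)=\sum_{P\in L}\mathcal{K}(P)$; it is a $(t\bmod q)$-arc if $\mathcal{K}(L)\equiv t\pmod q$ for every line $L$. A $(t\bmod q)$-arc $\mathcal{K}$ in $\mathrm{PG}(r,q)$ is called lifted if there exist an integer $s$ with $1\le s<r$, a projective $s$-space $\Sigma$, a projective $(r-s-1)$-space $\Gamma$ disjoint from $\Sigma$, and a $(t\bmod q)$-arc $\mathcal{K}_0$ in $\Sigma$ such that $\mathcal{K}(P)=t$ for every point $P\in\Gamma$ and $\mathcal{K}(Q)=\mathcal{K}_0(\langle\Gamma,Q\rangle\cap\Sigma)$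 for every point $Q\notin\Gamma$. *)

theory Defs
  imports "HOL-Analysis.Cartesian_Space" "HOL-Number_Theory.Cong"
begin

text \<open>
  The projective space of dimension \<open>CARD('n) - 1\<close> over the finite field \<open>'a\<close> is modelled by the
  linear subspaces of \<open>'a ^ 'n\<close>: a projective \<open>k\<close>-space is a linear subspace of dimension \<open>k + 1\<close>,
  and incidence is inclusion. In particular a point is the set of all vectors in a
  one-dimensional subspace, and the point \<open>P(x)\<close> is \<open>vec.span {x}\<close>.
\<close>

definition proj_space :: "nat \<Rightarrow> ('a::field ^ 'n::finite) set \<Rightarrow> bool" where
  "proj_space k S \<longleftrightarrow> vec.subspace S \<and> vec.dim S = k + 1"

definition points_of :: "('a::field ^ 'n::finite) set \<Rightarrow> ('a ^ 'n) set set" where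
  "points_of S = {P. proj_space 0 P \<and> P \<subseteq> S}"

text \<open>
  An arc is a function into \<open>nat\<close> on sets of vectors, of which only the values at points matter.
  The predicate \<open>mod_arc t S K\<close> says that the restriction of \<open>K\<close> to the points of the subspace
  \<open>S\<close> is a \<open>(t mod q)\<close>-arc in \<open>S\<close>, where \<open>q = CARD('a)\<close>.
\<close>

definition mod_arc ::
  "nat \<Rightarrow> ('a::{field,finite} ^ 'n::finite) set \<Rightarrow> (('a ^ 'n) set \<Rightarrow> nat) \<Rightarrow> bool" where
  "mod_arc t S K \<longleftrightarrow>
     (\<forall>L. proj_space 1 L \<and> L \<subseteq> S \<longrightarrow> [(\<Sum>P\<in>points_of L. K P) = t] (mod CARD('a)))"

text \<open>
  For a point \<open>Q\<close> outside \<open>\<Gamma>\<close>, the linear subspace \<open>vec.span (\<Gamma> \<union> Q) \<inter> \<Sigma>\<close> is one-dimensional,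
  so it is the intersection point of \<open>\<langle>\<Gamma>, Q\<rangle>\<close> and \<open>\<Sigma>\<close>.
\<close>

definition lifted ::
  "nat \<Rightarrow> (('a::{field,finite} ^ 'n::finite) set \<Rightarrow> nat) \<Rightarrow> bool" where
  "lifted t K \<longleftrightarrow>
     (let r = CARD('n) - 1 in
      \<exists>s \<Sigma> \<Gamma> K0. 1 \<le> s \<and> s < r \<and>
        proj_space s \<Sigma> \<and> proj_space (r - s - 1) \<Gamma> \<and> points_of \<Gamma> \<inter> points_of \<Sigma> = {} \<and>
        mod_arc t \<Sigma> K0 \<and>
        (\<forall>P\<in>points_of \<Gamma>. K P = t) \<and>
        (\<forall>Q\<in>points_of UNIV - points_of \<Gamma>. K Q = K0 (vec.span (\<Gamma> \<union> Q) \<inter> \<Sigma>)))"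

text \<open>
  In the following, \<open>m\<close> is the square root of the field order, so that \<open>a \<mapsto> a ^ m\<close> is the
  involution; forms are linear in the first and semilinear in the second argument.
\<close>

definition hermitian_form ::
  "nat \<Rightarrow> ('a::field ^ 'n::finite \<Rightarrow> 'a ^ 'n \<Rightarrow> 'a) \<Rightarrow> bool" where
  "hermitian_form m h \<longleftrightarrow>
     (\<forall>x y z. h (x + y) z = h x z + h y z) \<and>
     (\<forall>x y z. h x (y + z) = h x y + h x z) \<and>
     (\<forall>c x y. h (c *s x) y = c * h x y) \<and>
     (\<forall>c x y. h x (c *s y) = c ^ m * h x y) \<and>
     (\<forall>x y. h y x = h x y ^ m)"

definition nondegenerate_form ::
  "('a::field ^ 'n::finite \<Rightarrow> 'a ^ 'n \<Rightarrow> 'a) \<Rightarrow> bool" where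
  "nondegenerate_form h \<longleftrightarrow> (\<forall>x. (\<forall>y. h x y = 0) \<longrightarrow> x = 0)"

definition variety_of_form ::
  "('a::field ^ 'n::finite \<Rightarrow> 'a ^ 'n \<Rightarrow> 'a) \<Rightarrow> ('a ^ 'n) set set" where
  "variety_of_form h = {vec.span {x} | x. x \<noteq> 0 \<and> h x x = 0}"

definition hermitian_variety :: "nat \<Rightarrow> ('a::field ^ 'n::finite) set set \<Rightarrow> bool" where
  "hermitian_variety m H \<longleftrightarrow> (\<exists>h. hermitian_form m h \<and> H = variety_of_form h)"

definition nondegenerate_hermitian_variety ::
  "nat \<Rightarrow> ('a::field ^ 'n::finite) set set \<Rightarrow> bool" where
  "nondegenerate_hermitian_variety m H \<longleftrightarrow>
     (\<exists>h. hermitian_form m h \<and> nondegenerate_form h \<and> H = variety_of_form h)"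

end

theory Submission
  imports Defs "HOL-Computational_Algebra.Polynomial"
begin

text \<open>
  For an isotropic point \<open>x\<close> and a vector \<open>y\<close>, the form on the points \<open>y + a x\<close> of the line
  \<open>\<langle>x, y\<rangle>\<close> takes the values \<open>h(y, y) + Tr(a h(x, y))\<close>, and if \<open>h(x, y) \<noteq> 0\<close> each element of
  \<open>GF(m)\<close> is attained exactly \<open>m\<close> times. So a line through \<open>x\<close> carries \<open>1\<close>, \<open>m + 1\<close> or
  \<open>m\<^sup>2 + 1\<close> isotropic points, and surjectivity of the norm shows that every line has an isotropic
  point. If the arc were lifted with vertex \<open>\<Gamma>\<close>, a point \<open>x\<close> of \<open>\<Gamma>\<close> would be isotropic and the
  arc would be constant on each line through \<open>x\<close> outside \<open>x\<close>; taking \<open>y\<close> with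
  \<open>h(x, y) \<noteq> 0\<close> this contradicts \<open>0 < m < m\<^sup>2\<close>.
\<close>

section \<open>Trace and norm of a quadratic extension\<close>

text \<open>Multiplication by \<open>x \<noteq> 0\<close> permutes the nonzero elements, so their
  product is unchanged when multiplied by \<open>x ^ (q - 1)\<close>; cancelling it leaves
  \<open>x ^ (q - 1) = 1\<close>.\<close>

lemma finite_field_power_card:
  fixes x :: "'a::{field,finite}"
  shows "x ^ CARD('a) = x"
proof (cases "x = 0")
  case True
  then show ?thesis by (simp add: finite_UNIV_card_ge_0)
next
  case False
  let ?U = "UNIV - {0::'a}"
  have inj: "inj_on ((*) x) ?U"
    using False by (auto simp: inj_on_def)
  have img: "(*) x ` ?U = ?U"
    by (rule card_subset_eq) (use False inj in \<open>auto simp: card_image\<close>)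
  have "(\<Prod>y\<in>?U. y) = (\<Prod>y\<in>?U. x * y)"
    using prod.reindex[OF inj, of "\<lambda>y. y"] img by simp
  also have "\<dots> = x ^ card ?U * (\<Prod>y\<in>?U. y)"
    by (simp add: prod.distrib)
  finally have "x ^ card ?U = 1"
    by simp
  moreover have "CARD('a) = Suc (card ?U)"
    by (metis UNIV_I card_Suc_Diff1 finite_class.finite_UNIV)
  ultimately show ?thesis by (metis mult.right_neutral power_Suc)
qed

lemma card_UNIV_field_ge_2: "CARD('a::{field,finite}) \<ge> 2"
proof -
  have "card {0, 1::'a} \<le> CARD('a)"
    by (rule card_mono) auto
  then show ?thesis by simp
qed

text \<open>Pigeonhole: one fibre smaller than \<open>k\<close> would push the total strictly below
  \<open>k * card B \<le> k * n = card A\<close>. Upper bounds from counting roots thus become exact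
  fibre sizes, for the trace and for the norm alike.\<close>

lemma card_fibre_eq:
  assumes "finite A" and "finite B" and "f ` A \<subseteq> B"
    and fibre: "\<And>b. b \<in> B \<Longrightarrow> card {a \<in> A. f a = b} \<le> k"
    and "card A = k * n" and "card B \<le> n" and "b \<in> B"
  shows "card {a \<in> A. f a = b} = k"
proof (rule ccontr)
  assume "card {a \<in> A. f a = b} \<noteq> k"
  with fibre[OF \<open>b \<in> B\<close>] have "card {a \<in> A. f a = b} < k" by simp
  then have "(\<Sum>b\<in>B. card {a \<in> A. f a = b}) < (\<Sum>b\<in>B. k)"
    using fibre \<open>b \<in> B\<close> \<open>finite B\<close> by (intro sum_strict_mono_ex1) auto
  moreover have "card A = (\<Sum>b\<in>B. card {a \<in> A. f a = b})"
  proof -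
    have "A = (\<Union>b\<in>B. {a \<in> A. f a = b})"
      using assms(3) by auto
    then have "card A = card (\<Union>b\<in>B. {a \<in> A. f a = b})"
      by simp
    also have "\<dots> = (\<Sum>b\<in>B. card {a \<in> A. f a = b})"
      using assms(1,2) by (intro card_UN_disjoint) auto
    finally show ?thesis .
  qed
  moreover have "k * card B \<le> k * n"
    using assms(6) by simp
  ultimately show False
    using assms(5) by (simp add: mult.commute)
qed

lemma card_power_eq_le:
  fixes d :: "'a::field"
  assumes "k > 0"
  shows "card {x. x ^ k = d} \<le> k"
proof -
  let ?p = "monom 1 k + [:- d:]"
  have deg: "degree ?p = k"
    using assms by (subst degree_add_eq_left) (auto simp: degree_monom_eq)
  then have "?p \<noteq> 0" using assms by auto
  then have "card {x. poly ?p x = 0} \<le> k"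
    using card_poly_roots_bound[of ?p] deg by simp
  moreover have "poly ?p x = 0 \<longleftrightarrow> x ^ k = d" for x
    by (simp add: poly_monom)
  ultimately show ?thesis by simp
qed

text \<open>A root count for a polynomial of degree \<open>k\<close>; \<open>k \<ge> 2\<close> keeps
  the linear term away from the leading one. The case \<open>c = 1\<close> bounds the trace fibres,
  and \<open>c = -1\<close>, \<open>d = 0\<close> bounds the elements fixed by the
  involution.\<close>

lemma card_power_add_linear_le:
  fixes c d :: "'a::field"
  assumes "k \<ge> 2"
  shows "card {x. x ^ k + c * x = d} \<le> k"
proof -
  let ?p = "monom 1 k + [:-d, c:]"
  have deg: "degree ?p = k"
    using assms by (subst degree_add_eq_left) (auto simp: degree_monom_eq)
  then have "?p \<noteq> 0" using assms by auto
  then have "card {x. poly ?p x = 0} \<le> k"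
    using card_poly_roots_bound[of ?p] deg by simp
  moreover have "poly ?p x = 0 \<longleftrightarrow> x ^ k + c * x = d" for x
    by (auto simp: poly_monom algebra_simps eq_neg_iff_add_eq_0)
  ultimately show ?thesis by simp
qed

lemma card_square_field:
  assumes "CARD('a::{field,finite}) = m ^ 2"
  shows "m \<ge> 2"
proof (rule ccontr)
  assume "\<not> m \<ge> 2"
  then have "m = 0 \<or> m = 1" by auto
  then show False using assms card_UNIV_field_ge_2[where 'a = 'a] by auto
qed

lemma power_sqrt_card_twice:
  fixes x :: "'a::{field,finite}"
  assumes "CARD('a) = m ^ 2"
  shows "(x ^ m) ^ m = x"
  using finite_field_power_card[of x] assms by (simp add: power2_eq_square flip: power_mult)

text \<open>The trace maps \<open>m * m\<close> elements into at most \<open>m\<close> fixed ones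
  with fibres of size at most \<open>m\<close>, so every fibre has size \<open>m\<close>. Additivity
  of the involution is an assumption here; it is later read off a Hermitian form.\<close>

lemma card_trace_fibre:
  fixes d :: "'a::{field,finite}"
  assumes q: "CARD('a) = m ^ 2"
    and add: "\<And>x y::'a. (x + y) ^ m = x ^ m + y ^ m"
    and "d ^ m = d"
  shows "card {x. x ^ m + x = d} = m"
proof -
  note m = card_square_field[OF q]
  have "card {x \<in> UNIV. x ^ m + x = d} = m"
  proof (rule card_fibre_eq[where B = "{d. d ^ m = d}" and n = m])
    show "range (\<lambda>x::'a. x ^ m + x) \<subseteq> {d. d ^ m = d}"
      by (auto simp: add power_sqrt_card_twice[OF q])
    show "card {x \<in> UNIV. x ^ m + x = b} \<le> m" for b :: 'a
      using card_power_add_linear_le[OF m, of 1 b] by simp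
    show "card {d::'a. d ^ m = d} \<le> m"
      using card_power_add_linear_le[OF m, of "- 1 :: 'a" 0] by simp
  qed (use assms in \<open>auto simp: power2_eq_square\<close>)
  then show ?thesis by simp
qed

text \<open>On nonzero elements the same count applies: \<open>(m + 1) * (m - 1)\<close> arguments,
  fibres of size at most \<open>m + 1\<close>, and at most \<open>m - 1\<close> nonzero fixed
  values.\<close>

lemma norm_surj:
  fixes d :: "'a::{field,finite}"
  assumes q: "CARD('a) = m ^ 2" and "d ^ m = d"
  shows "\<exists>x. x ^ (m + 1) = d"
proof (cases "d = 0")
  case True
  then show ?thesis by (intro exI[of _ 0]) simp
next
  case False
  note m = card_square_field[OF q]
  have pow: "d \<noteq> 0 \<Longrightarrow> d ^ m = d \<longleftrightarrow> d ^ (m - 1) = 1" for d :: 'a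
    using m by (cases m) auto
  have "card {x \<in> UNIV - {0}. x ^ (m + 1) = d} = m + 1"
  proof (rule card_fibre_eq[where B = "{d. d \<noteq> 0 \<and> d ^ m = d}" and n = "m - 1"])
    show "(\<lambda>x::'a. x ^ (m + 1)) ` (UNIV - {0}) \<subseteq> {d. d \<noteq> 0 \<and> d ^ m = d}"
      using power_sqrt_card_twice[OF q] by (auto simp: power_mult_distrib mult.commute)
    show "card {x \<in> UNIV - {0}. x ^ (m + 1) = b} \<le> m + 1" for b :: 'a
      by (rule order_trans[OF card_mono card_power_eq_le[of "m + 1" b]]) auto
    have "card {d::'a. d \<noteq> 0 \<and> d ^ m = d} \<le> card {d::'a. d ^ (m - 1) = 1}"
      using pow by (intro card_mono) auto
    also have "\<dots> \<le> m - 1"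
      using m by (intro card_power_eq_le) simp
    finally show "card {d::'a. d \<noteq> 0 \<and> d ^ m = d} \<le> m - 1" .
    show "card (UNIV - {0::'a}) = (m + 1) * (m - 1)"
      using m q by (simp add: card_Diff_singleton power2_eq_square algebra_simps)
  qed (use False assms in auto)
  then show ?thesis
    by (metis (mono_tags, lifting) Collect_empty_eq add_is_0 card.empty one_neq_zero)
qed

section \<open>Points of a line\<close>

lemma proj_space_0_iff:
  fixes P :: "('a::field ^ 'n::finite) set"
  shows "proj_space 0 P \<longleftrightarrow> (\<exists>x. x \<noteq> 0 \<and> P = vec.span {x})"
proof
  assume P: "proj_space 0 P"
  then have "\<not> P \<subseteq> {0}"
    unfolding proj_space_def using vec.dim_eq_0[of P] by simp
  then obtain x where x: "x \<in> P" "x \<noteq> 0" by auto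
  have "vec.span {x} \<subseteq> P"
    using P x by (intro vec.span_minimal) (auto simp: proj_space_def)
  then have "vec.span {x} = P"
    using P x by (intro vec.subspace_dim_equal) (auto simp: proj_space_def)
  with x show "\<exists>x. x \<noteq> 0 \<and> P = vec.span {x}" by auto
qed (auto simp: proj_space_def)

lemma line_eq_span:
  fixes L :: "('a::field ^ 'n::finite) set"
  assumes L: "proj_space 1 L" and u: "u \<in> L" "u \<noteq> 0"
  obtains v where "v \<in> L" "v \<notin> vec.span {u}" "L = vec.span {v, u}"
proof -
  have sub: "vec.subspace L" and dim: "vec.dim L = 2"
    using L by (auto simp: proj_space_def)
  have "\<not> L \<subseteq> vec.span {u}"
    using vec.dim_subset[of L "vec.span {u}"] dim u by auto
  then obtain v where v: "v \<in> L" "v \<notin> vec.span {u}" by auto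
  have "vec.span {v, u} \<subseteq> L"
    using sub u v by (intro vec.span_minimal) auto
  then have "vec.span {v, u} = L"
    using sub dim u v by (intro vec.subspace_dim_equal) (auto simp: vec.dim_insert)
  with v that show thesis by auto
qed

lemma add_scale_notin_span:
  assumes "v \<notin> vec.span {u}"
  shows "v + a *s u \<notin> vec.span {u}"
  using assms vec.span_add_eq2[of "a *s u" "{u}" v]
  by (metis insertI1 vec.span_base vec.span_scale)

text \<open>Parametrises a line by its point \<open>u\<close> and one affine point per scalar: a
  vector with nonzero \<open>v\<close>-coefficient can be rescaled to make that coefficient
  \<open>1\<close>.\<close>

lemma points_of_span_pair:
  fixes u v :: "'a::field ^ 'n::finite"
  assumes "u \<noteq> 0" and v: "v \<notin> vec.span {u}"
  shows "points_of (vec.span {v, u}) =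
    insert (vec.span {u}) (range (\<lambda>a. vec.span {v + a *s u}))"
proof (intro equalityI subsetI)
  fix P assume "P \<in> points_of (vec.span {v, u})"
  then obtain x where x: "x \<noteq> 0" "P = vec.span {x}" "vec.span {x} \<subseteq> vec.span {v, u}"
    by (auto simp: points_of_def proj_space_0_iff)
  then have "x \<in> vec.span {v, u}"
    using vec.span_base[of x "{x}"] by auto
  then obtain k l where "x - k *s v = l *s u"
    by (auto simp: vec.span_insert[of v] vec.span_singleton)
  then have xe: "x = k *s v + l *s u"
    by (simp add: algebra_simps)
  show "P \<in> insert (vec.span {u}) (range (\<lambda>a. vec.span {v + a *s u}))"
  proof (cases "k = 0")
    case True
    then have "l \<noteq> 0" using xe x by auto
    then have "vec.span {l *s u} = vec.span {u}"
      using vec.span_image_scale[of "{u}" "\<lambda>_. l"] by simp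
    then show ?thesis using True xe x by auto
  next
    case False
    then have "x = k *s (v + (l / k) *s u)"
      using xe by (simp add: vector_add_ldistrib vector_smult_assoc)
    then have "P = vec.span {v + (l / k) *s u}"
      using x vec.span_image_scale[of "{v + (l / k) *s u}" "\<lambda>_. k"] False by simp
    then show ?thesis by auto
  qed
next
  fix P assume "P \<in> insert (vec.span {u}) (range (\<lambda>a. vec.span {v + a *s u}))"
  moreover have "v + a *s u \<noteq> 0" for a
    using add_scale_notin_span[OF v, of a] vec.span_zero by metis
  moreover have "v + a *s u \<in> vec.span {v, u}" for a
    by (intro vec.span_add vec.span_scale vec.span_base) auto
  moreover have "u \<in> vec.span {v, u}"
    by (intro vec.span_base) simp
  ultimately obtain x where "x \<noteq> 0" "P = vec.span {x}" "x \<in> vec.span {v, u}"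
    using assms(1) by blast
  moreover from this have "P \<subseteq> vec.span {v, u}"
    by (metis empty_subsetI insert_subset vec.span_minimal vec.subspace_span)
  ultimately show "P \<in> points_of (vec.span {v, u})"
    by (auto simp: points_of_def proj_space_0_iff)
qed

lemma inj_affine_points:
  fixes u v :: "'a::field ^ 'n::finite"
  assumes "u \<noteq> 0" and v: "v \<notin> vec.span {u}"
  shows "inj (\<lambda>a. vec.span {v + a *s u})"
proof (rule injI)
  fix a b
  assume "vec.span {v + a *s u} = vec.span {v + b *s u}"
  then have "v + a *s u \<in> vec.span {v + b *s u}"
    using vec.span_base[of "v + a *s u" "{v + a *s u}"] by simp
  then obtain k where k: "v + a *s u = k *s (v + b *s u)"
    by (auto simp: vec.span_singleton)
  then have e: "(1 - k) *s v = (k * b - a) *s u"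
    by (simp add: vec_eq_iff algebra_simps)
  \<comment> \<open>Otherwise \<open>v\<close> would be a multiple of \<open>u\<close>.\<close>
  have "k = 1"
  proof (rule ccontr)
    assume "k \<noteq> 1"
    then have "v = ((k * b - a) / (1 - k)) *s u"
      using arg_cong[OF e, of "\<lambda>x. (1 / (1 - k)) *s x"] by (simp add: vector_smult_assoc)
    then show False using v by (auto simp: vec.span_singleton)
  qed
  with e assms(1) show "a = b" by simp
qed

lemma sum_points_of_span_pair:
  fixes u v :: "'a::{field,finite} ^ 'n::finite"
  assumes "u \<noteq> 0" and v: "v \<notin> vec.span {u}"
  shows "(\<Sum>P\<in>points_of (vec.span {v, u}). f P) =
    f (vec.span {u}) + (\<Sum>a\<in>UNIV. f (vec.span {v + a *s u}))"
proof -
  let ?R = "range (\<lambda>a. vec.span {v + a *s u})"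
  have "vec.span {u} \<noteq> vec.span {v + a *s u}" for a
    using add_scale_notin_span[OF v, of a] vec.span_base[of "v + a *s u" "{v + a *s u}"] by auto
  then have "vec.span {u} \<notin> ?R" by blast
  then have "(\<Sum>P\<in>points_of (vec.span {v, u}). f P) = f (vec.span {u}) + (\<Sum>P\<in>?R. f P)"
    unfolding points_of_span_pair[OF assms] by (intro sum.insert) simp_all
  also have "(\<Sum>P\<in>?R. f P) = (\<Sum>a\<in>UNIV. f (vec.span {v + a *s u}))"
    unfolding sum.reindex[OF inj_affine_points[OF assms]] comp_def ..
  finally show ?thesis .
qed

section \<open>Hermitian forms\<close>

locale finite_hermitian =
  fixes m :: nat and h :: "'a::{field,finite} ^ 'n::finite \<Rightarrow> 'a ^ 'n \<Rightarrow> 'a"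
  assumes card: "CARD('a) = m ^ 2" and herm: "hermitian_form m h"
begin

lemma form_simps:
  "h (x + y) z = h x z + h y z" "h x (y + z) = h x y + h x z"
  "h (c *s x) y = c * h x y" "h x (c *s y) = c ^ m * h x y"
  using herm unfolding hermitian_form_def by blast+

lemma form_sym: "h y x = h x y ^ m"
  using herm unfolding hermitian_form_def by blast

lemma m_ge_2: "m \<ge> 2"
  using card_square_field[OF card] .

text \<open>Expanding \<open>h x ((c + d) *s y)\<close> by semilinearity and by additivity gives
  both sides times \<open>h x y\<close>, which cancels. The involution is thus additive without
  first showing that \<open>m\<close> is a power of the characteristic.\<close>

lemma power_m_add:
  assumes "h x y \<noteq> 0"
  shows "(c + d :: 'a) ^ m = c ^ m + d ^ m"
proof -
  have "(c + d) ^ m * h x y = (c ^ m + d ^ m) * h x y"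
    by (metis form_simps(2,4) distrib_right vector_sadd_rdistrib)
  with assms show ?thesis by simp
qed

lemma power_m_minus:
  assumes "h x y \<noteq> 0"
  shows "(- c :: 'a) ^ m = - (c ^ m)"
proof -
  have "c ^ m + (- c) ^ m = 0"
    using power_m_add[OF assms, of c "- c"] m_ge_2 by (simp add: power_0_left)
  then show ?thesis by (simp add: eq_neg_iff_add_eq_0 add.commute)
qed

text \<open>Isotropy does not depend on the representative of a point, since scaling by
  \<open>c\<close> multiplies \<open>h z z\<close> by \<open>c * c ^ m\<close>.\<close>

lemma span_in_variety_iff:
  assumes "x \<noteq> 0"
  shows "vec.span {x} \<in> variety_of_form h \<longleftrightarrow> h x x = 0"
proof
  assume "vec.span {x} \<in> variety_of_form h"
  then obtain z where z: "vec.span {x} = vec.span {z}" "h z z = 0"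
    by (auto simp: variety_of_form_def)
  then have "x \<in> vec.span {z}"
    using vec.span_base[of x "{x}"] by auto
  then obtain c where "x = c *s z"
    by (auto simp: vec.span_singleton)
  with z show "h x x = 0" by (simp add: form_simps)
qed (use assms in \<open>auto simp: variety_of_form_def\<close>)

lemma arc_at_point:
  assumes "\<forall>P\<in>points_of UNIV. K P = (if P \<in> variety_of_form h then m else 0)" and "x \<noteq> 0"
  shows "K (vec.span {x}) = (if h x x = 0 then m else 0)"
  using assms span_in_variety_iff[OF assms(2)] by (auto simp: points_of_def proj_space_0_iff)

lemma card_isotropic_affine:
  assumes "h x x = 0" and xy: "h x y \<noteq> 0"
  shows "card {a. h (y + a *s x) (y + a *s x) = 0} = m"
proof -
  have "h (y + a *s x) (y + a *s x) = h y y + ((a * h x y) ^ m + a * h x y)" for a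
    using assms(1) form_sym[of y x] by (simp add: form_simps power_mult_distrib)
  then have "h (y + a *s x) (y + a *s x) = 0 \<longleftrightarrow> (a * h x y) ^ m + a * h x y = - h y y" for a
    by (simp add: eq_neg_iff_add_eq_0 add.commute)
  \<comment> \<open>The substitution \<open>t = a * h x y\<close> is a bijection of the field and
    turns isotropy into a trace equation, whose right side is fixed by the involution.\<close>
  then have "card {a. h (y + a *s x) (y + a *s x) = 0} = card {t. t ^ m + t = - h y y}"
    using xy
    by (intro bij_betw_same_card[of "\<lambda>a. a * h x y"] bij_betwI[where g = "\<lambda>t. t / h x y"]) auto
  also have "\<dots> = m"
    using power_m_add[OF xy] power_m_minus[OF xy] form_sym[of y y]
    by (intro card_trace_fibre[OF card]) auto
  finally show ?thesis .
qed

lemma line_has_isotropic: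
  assumes L: "proj_space 1 L"
  obtains u where "u \<in> L" "u \<noteq> 0" "h u u = 0"
proof -
  have sub: "vec.subspace L" and "\<not> L \<subseteq> {0}"
    using L vec.dim_eq_0[of L] by (auto simp: proj_space_def)
  then obtain u where u: "u \<in> L" "u \<noteq> 0" by auto
  show thesis
  proof (cases "h u u = 0")
    case True
    with u that show thesis by auto
  next
    case False
    obtain v where v: "v \<in> L" "v \<notin> vec.span {u}"
      using line_eq_span[OF L u] by metis
    \<comment> \<open>Gram-Schmidt: subtracting the projection of \<open>v\<close> onto the
      anisotropic \<open>u\<close> makes \<open>w\<close> orthogonal to \<open>u\<close>, so no
      cross terms remain in the form on \<open>w + a *s u\<close>.\<close>
    define w where "w = v + (- (h v u / h u u)) *s u"
    have wu: "h w u = 0"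
      using False unfolding w_def form_simps by simp
    then have uw: "h u w = 0"
      using form_sym[of u w] m_ge_2 by simp
    \<comment> \<open>Diagonal values of the form are fixed by the involution, hence so is this
      quotient, and it is therefore a norm.\<close>
    have "(- h w w / h u u) ^ m = - h w w / h u u"
      using power_m_minus[OF False, of "h w w"] form_sym[of w w] form_sym[of u u]
      by (metis power_divide)
    then obtain a where a: "a ^ (m + 1) = - h w w / h u u"
      using norm_surj[OF card] by blast
    have "h (w + a *s u) (w + a *s u) = h w w + a ^ (m + 1) * h u u"
      by (simp add: form_simps wu uw algebra_simps)
    also have "\<dots> = 0"
      using a False by simp
    finally have "h (w + a *s u) (w + a *s u) = 0" .
    moreover have "w + a *s u \<in> L"
      unfolding w_def using sub u v by (intro vec.subspace_add vec.subspace_scale) auto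
    moreover have "w + a *s u \<noteq> 0"
      unfolding w_def using add_scale_notin_span[OF add_scale_notin_span[OF v(2)]] vec.span_zero
      by metis
    ultimately show thesis using that by blast
  qed
qed

section \<open>Line sums of the arc, and the exclusion of cones\<close>

lemma mod_arc_variety:
  assumes K: "\<forall>P\<in>points_of UNIV. K P = (if P \<in> variety_of_form h then m else 0)"
  shows "mod_arc m UNIV K"
  unfolding mod_arc_def
proof (intro allI impI)
  fix L :: "('a ^ 'n) set"
  assume "proj_space 1 L \<and> L \<subseteq> UNIV"
  then have L: "proj_space 1 L" by simp
  \<comment> \<open>With an isotropic base point the line sum is \<open>m + N * m\<close>, where
    \<open>N\<close> counts the other isotropic points. As the field has order \<open>m ^ 2\<close>,
    it remains to show that \<open>m\<close> divides \<open>N\<close>.\<close>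
  obtain u where u: "u \<in> L" "u \<noteq> 0" and uu: "h u u = 0"
    using line_has_isotropic[OF L] .
  obtain v where v: "v \<notin> vec.span {u}" and Le: "L = vec.span {v, u}"
    using line_eq_span[OF L u] .
  note Kx = arc_at_point[OF K]
  have nz: "v + a *s u \<noteq> 0" for a
    using add_scale_notin_span[OF v, of a] vec.span_zero by metis
  define N where "N = card {a. h (v + a *s u) (v + a *s u) = 0}"
  have "(\<Sum>a\<in>UNIV. K (vec.span {v + a *s u})) = N * m"
    by (simp add: Kx[OF nz] sum.If_cases N_def)
  then have sum: "(\<Sum>P\<in>points_of L. K P) = m + N * m"
    unfolding Le sum_points_of_span_pair[OF u(2) v] by (simp add: Kx[OF u(2)] uu)
  have "m dvd N"
  \<comment> \<open>If \<open>u\<close> and \<open>v\<close> are orthogonal, the form is constant on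
    the affine points and \<open>N\<close> is \<open>0\<close> or \<open>m ^ 2\<close>; otherwise
    the trace count gives \<open>N = m\<close>.\<close>
  proof (cases "h u v = 0")
    case True
    then have "h v u = 0"
      using form_sym[of v u] m_ge_2 by simp
    with True uu have "h (v + a *s u) (v + a *s u) = h v v" for a
      by (simp add: form_simps)
    then have "N = 0 \<or> N = m ^ 2"
      unfolding N_def card[symmetric] by (cases "h v v = 0") auto
    then show ?thesis by (auto simp: power2_eq_square)
  next
    case False
    then show ?thesis
      using card_isotropic_affine[OF uu False] by (simp add: N_def)
  qed
  then have "CARD('a) dvd N * m"
    unfolding card power2_eq_square by (rule mult_dvd_mono) simp
  then show "[(\<Sum>P\<in>points_of L. K P) = m] (mod CARD('a))"
    unfolding sum cong_def by (metis add.right_neutral mod_add_right_eq mod_eq_0_iff_dvd)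
qed

lemma not_lifted_variety:
  assumes K: "\<forall>P\<in>points_of UNIV. K P = (if P \<in> variety_of_form h then m else 0)"
    and "nondegenerate_form h"
  shows "\<not> lifted m K"
proof
  assume "lifted m K"
  then obtain k \<Sigma> \<Gamma> K0 where \<Gamma>: "proj_space k \<Gamma>"
    and vertex: "\<forall>P\<in>points_of \<Gamma>. K P = m"
    and cone: "\<forall>Q\<in>points_of UNIV - points_of \<Gamma>. K Q = K0 (vec.span (\<Gamma> \<union> Q) \<inter> \<Sigma>)"
    unfolding lifted_def Let_def by blast
  have sub: "vec.subspace \<Gamma>" and "\<not> \<Gamma> \<subseteq> {0}"
    using \<Gamma> vec.dim_eq_0[of \<Gamma>] by (auto simp: proj_space_def)
  then obtain x where x: "x \<in> \<Gamma>" "x \<noteq> 0" by auto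
  note Kx = arc_at_point[OF K]
  have mem: "vec.span {z} \<in> points_of \<Gamma> \<longleftrightarrow> z \<in> \<Gamma>" if "z \<noteq> 0" for z
    using that sub vec.span_base[of z "{z}"] vec.span_minimal[of "{z}" \<Gamma>]
    by (auto simp: points_of_def proj_space_0_iff)
  have xx: "h x x = 0"
    using vertex x mem[of x] Kx[of x] m_ge_2 by (auto split: if_splits)
  obtain y where xy: "h x y \<noteq> 0"
    using assms(2) x by (auto simp: nondegenerate_form_def)
  \<comment> \<open>Pairing with the isotropic \<open>x\<close> gives
    \<open>h x y \<noteq> 0\<close> for every \<open>a\<close>.\<close>
  have nz: "y + a *s x \<noteq> 0" for a
  proof
    assume "y + a *s x = 0"
    then have "h x (y + a *s x) = h x (0 *s x)" by simp
    then show False using xy xx m_ge_2 unfolding form_simps by simp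
  qed
  have mem_shift: "y + a *s x \<in> \<Gamma> \<longleftrightarrow> y \<in> \<Gamma>" for a
    using sub x vec.subspace_add vec.subspace_diff vec.subspace_scale
    by (metis add_diff_cancel_right')
  \<comment> \<open>Inside the vertex every value is \<open>m\<close>. Outside it, shifting by a
    multiple of \<open>x \<in> \<Gamma>\<close> leaves the span with \<open>\<Gamma>\<close>
    unchanged, so the projection to \<open>\<Sigma>\<close> is the same.\<close>
  have const: "K (vec.span {y + a *s x}) = K (vec.span {y + b *s x})" for a b
  proof (cases "y \<in> \<Gamma>")
    case True
    then show ?thesis
      using vertex mem[OF nz] mem_shift by metis
  next
    case False
    have "vec.span (\<Gamma> \<union> vec.span {y + a *s x}) \<subseteq> vec.span (\<Gamma> \<union> vec.span {y + b *s x})" for a b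
    proof (intro vec.span_minimal Un_least vec.subspace_span)
      have "(y + b *s x) + (a - b) *s x \<in> vec.span (\<Gamma> \<union> vec.span {y + b *s x})"
        using x by (intro vec.span_add vec.span_scale vec.span_base) (auto intro: vec.span_base)
      moreover have "(y + b *s x) + (a - b) *s x = y + a *s x"
        by (simp add: vec_eq_iff algebra_simps)
      ultimately show "{y + a *s x} \<subseteq> vec.span (\<Gamma> \<union> vec.span {y + b *s x})" by simp
    qed (auto intro: vec.span_base)
    then have "vec.span (\<Gamma> \<union> vec.span {y + a *s x}) = vec.span (\<Gamma> \<union> vec.span {y + b *s x})"
      by blast
    moreover have "vec.span {y + c *s x} \<in> points_of UNIV - points_of \<Gamma>" for c
    proof -
      have "vec.span {y + c *s x} \<in> points_of UNIV"
        using nz[of c] by (auto simp: points_of_def proj_space_0_iff)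
      then show ?thesis
        using False mem[OF nz] mem_shift by simp
    qed
    ultimately show ?thesis using cone by metis
  qed
  let ?Z = "{a. h (y + a *s x) (y + a *s x) = 0}"
  \<comment> \<open>As \<open>m \<noteq> 0\<close>, the value of \<open>K\<close> at a point decides
    whether it is isotropic, so \<open>?Z\<close> is all or nothing, whereas the trace count gives
    it exactly \<open>m\<close> elements.\<close>
  have "a \<in> ?Z \<longleftrightarrow> b \<in> ?Z" for a b
    using const[of a b] Kx[OF nz, of a] Kx[OF nz, of b] m_ge_2 by (auto split: if_splits)
  then have "?Z = {} \<or> ?Z = UNIV" by blast
  then have "card ?Z = 0 \<or> card ?Z = m ^ 2"
  proof
    assume "?Z = UNIV"
    then show ?thesis unfolding card[symmetric] by (simp only: simp_thms)
  qed simp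
  then show False
    using card_isotropic_affine[OF xx xy] m_ge_2 by (auto simp: power2_eq_square)
qed

end

theorem theorem7:
  fixes H :: "('a::{field,finite} ^ 'n::finite) set set"
    and K' :: "('a ^ 'n) set \<Rightarrow> nat"
    and q m r :: nat
  assumes "CARD('a) = q" and "q = m ^ 2"
    and "CARD('n) = r + 1" and "r \<ge> 1"
    and "hermitian_variety m H"
    and "\<forall>P\<in>points_of UNIV. K' P = (if P \<in> H then m else 0)"
  shows "mod_arc m UNIV K' \<and> (nondegenerate_hermitian_variety m H \<longrightarrow> \<not> lifted m K')"
proof (intro conjI impI)
  have card: "CARD('a) = m ^ 2"
    using assms(1,2) by simp
  obtain h where h: "hermitian_form m h" "H = variety_of_form h"
    using assms(5) by (auto simp: hermitian_variety_def)
  interpret finite_hermitian m h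
    using card h by unfold_locales
  show "mod_arc m UNIV K'"
    using mod_arc_variety assms(6) h(2) by blast
  assume "nondegenerate_hermitian_variety m H"
  \<comment> \<open>The non-degenerate form \<open>g\<close> may differ from \<open>h\<close>, but
    both define the same point set \<open>H\<close>, so the description of \<open>K'\<close> carries
    over to \<open>g\<close>.\<close>
  then obtain g where g: "hermitian_form m g" "nondegenerate_form g" "H = variety_of_form g"
    by (auto simp: nondegenerate_hermitian_variety_def)
  interpret g: finite_hermitian m g
    using card g by unfold_locales
  show "\<not> lifted m K'"
    using g.not_lifted_variety assms(6) g(2,3) by blast
qed

end
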